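(* Let $m,n$ be fixed nonzero integers with $m+n\neq 0$. Let $\mathcal{U}=\begin{bmatrix}\mathcal{A}&\mathcal{M}\\ \mathcal{N}&\mathcal{B}\end{bmatrix}$ be a generalized matrix algebra whose characteristic is neither $|3mn(m+n)|$ nor $|m-n|$ (the latter condition being void if $m=n$). Suppose that $\frac12 I_{\mathcal{A}}\in\mathcal{A}$, $\frac12 I_{\mathcal{B}}\in\mathcal{B}$, and that for every $A\in\mathcal{A}$ and every $B\in\mathcal{B}$ there exists an integer $k$ such that $kI_{\mathcal{A}}+A$ is invertible in $\mathcal{A}$ and $kI_{\mathcal{B}}+B$ is invertible in $\mathcal{B}$. Assume that $\mathcal{M}$ is a faithful $(\mathcal{A},\mathcal{B})$-bimodule. If $\delta:\mathcal{U}\to\mathcal{U}$ is an $(m,n)$-derivable mapping at $I$ (the unit of $\mathcal{U}$), then $\delta$ is a Jordan derivation.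
   Context: Let $\mathcal{R}$ be a unital ring; algebras are associative $\mathcal{R}$-algebras and "linear" means $\mathcal{R}$-linear. A Morita context consists of unital $\mathcal{R}$-algebras $\mathcal{A},\mathcal{B}$, an $(\mathcal{A},\mathcal{B})$-bimodule $\mathcal{M}$, a $(\mathcal{B},\mathcal{A})$-bimodule $\mathcal{N}$, and bimodule homomorphisms $\phi:\mathcal{M}\otimes_{\mathcal{B}}\mathcal{N}\to\mathcal{A}$ and $\varphi:\mathcal{N}\otimes_{\mathcal{A}}\mathcal{M}\to\mathcal{B}$, written $MN=\phi(M\otimes N)$ and $NM=\varphi(N\otimes M)$, satisfying $(MN)M'=M(NM')$ and $(NM)N'=N(MN')$ for all $M,M'\in\mathcal{M}$, $N,N'\in\mathcal{N}$. The generalized matrix algebra $\mathcal{U}$ is the set of matrices $\begin{bmatrix}A&M\\N&B\end{bmatrix}$ ($A\in\mathcal{A}$, $M\in\mathcal{M}$, $N\in\mathcal{N}$, $B\in\mathcal{B}$) with matrix-like addition and multiplication; at least one of $\mathcal{M},\mathcal{N}$ is assumed nonzero. $I_{\mathcal{A}},I_{\mathcal{B}}$ are the units of $\mathcal{A},\mathcal{B}$; $\frac12 I_{\mathcal{A}}\in\mathcal{A}$ means $2I_{\mathcal{A}}$ is invertible in $\mathcal{A}$, and similarly for $\mathcal{B}$. $\mathcal{M}$ is a faithful $(\mathcal{A},\mathcal{B})$-bimodule if $A\mathcal{M}=0$ implies $A=0$ for $A\in\mathcal{A}$, and $\mathcal{M}B=0$ implies $B=0$ for $B\in\mathcal{B}$.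 For an integer $k\ge 2$, "the characteristic of $\mathcal{U}$ is not $k$" means: for every $X\in\mathcal{U}$, $kX=0$ implies $X=0$ (for $k=1$ this is automatic). A linear $\delta:\mathcal{U}\to\mathcal{U}$ is $(m,n)$-derivable at $Z\in\mathcal{U}$ if $m\delta(ST)+n\delta(TS)=m\delta(S)T+mS\delta(T)+n\delta(T)S+nT\delta(S)$ for all $S,T\in\mathcal{U}$ with $ST=Z$. $\delta$ is a Jordan derivation if $\delta(ST+TS)=\delta(S)T+S\delta(T)+\delta(T)S+T\delta(S)$ for all $S,T\in\mathcal{U}$. *)

theory Defs
  imports Main
begin

section \<open>Algebras and bimodules\<close>

text \<open>
  The scalar ring is an arbitrary unital ring of class \<open>ring_1\<close>, whereas the library's
  \<open>module\<close> locale requires commutative scalars.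
\<close>

locale left_module =
  fixes act :: "'r::ring_1 \<Rightarrow> 'v::ab_group_add \<Rightarrow> 'v"
  assumes act_add: "act r (x + y) = act r x + act r y"
    and add_act: "act (r + s) x = act r x + act s x"
    and mult_act: "act (r * s) x = act r (act s x)"
    and one_act: "act 1 x = x"

locale right_module =
  fixes act :: "'v::ab_group_add \<Rightarrow> 'r::ring_1 \<Rightarrow> 'v"
  assumes add_act: "act (x + y) r = act x r + act y r"
    and act_add: "act x (r + s) = act x r + act x s"
    and act_mult: "act x (r * s) = act (act x r) s"
    and act_one: "act x 1 = x"

locale unital_algebra = left_module scal
  for scal :: "'r::ring_1 \<Rightarrow> 'a::ring_1 \<Rightarrow> 'a" +
  assumes scal_mult_left: "scal r (x * y) = scal r x * y"
    and scal_mult_right: "scal r (x * y) = x * scal r y"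

locale bimodule =
  A: unital_algebra scalA + B: unital_algebra scalB +
  left_module scal + L: left_module lact + R: right_module ract
  for scalA :: "'r::ring_1 \<Rightarrow> 'a::ring_1 \<Rightarrow> 'a"
    and scalB :: "'r \<Rightarrow> 'b::ring_1 \<Rightarrow> 'b"
    and scal :: "'r \<Rightarrow> 'v::ab_group_add \<Rightarrow> 'v"
    and lact :: "'a \<Rightarrow> 'v \<Rightarrow> 'v"
    and ract :: "'v \<Rightarrow> 'b \<Rightarrow> 'v" +
  assumes lact_ract: "ract (lact a x) b = lact a (ract x b)"
    and lact_scal_left: "lact (scalA r a) x = scal r (lact a x)"
    and lact_scal_right: "lact a (scal r x) = scal r (lact a x)"
    and ract_scal_left: "ract (scal r x) b = scal r (ract x b)"
    and ract_scal_right: "ract x (scalB r b) = scal r (ract x b)"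

definition faithful_bimodule ::
    "('a::ring_1 \<Rightarrow> 'v::ab_group_add \<Rightarrow> 'v) \<Rightarrow> ('v \<Rightarrow> 'b::ring_1 \<Rightarrow> 'v) \<Rightarrow> bool" where
  "faithful_bimodule lact ract \<longleftrightarrow>
     (\<forall>a. (\<forall>x. lact a x = 0) \<longrightarrow> a = 0) \<and> (\<forall>b. (\<forall>x. ract x b = 0) \<longrightarrow> b = 0)"

text \<open>
  A bimodule homomorphism \<open>V \<otimes>\<^sub>B W \<rightarrow> A\<close>, for an \<open>(A,B)\<close>-bimodule \<open>V\<close> and a \<open>(B,A)\<close>-bimodule
  \<open>W\<close>, is given through the universal property of the tensor product: by a biadditive
  \<open>B\<close>-balanced map on \<open>V \<times> W\<close> that is \<open>A\<close>-linear on both outer sides. Linearity over the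
  scalar ring follows, since scalars act on \<open>V\<close> through \<open>A\<close>.
\<close>

locale bimodule_pairing =
  fixes lactV :: "'a::ring_1 \<Rightarrow> 'v::ab_group_add \<Rightarrow> 'v"
    and ractV :: "'v \<Rightarrow> 'b::ring_1 \<Rightarrow> 'v"
    and lactW :: "'b \<Rightarrow> 'w::ab_group_add \<Rightarrow> 'w"
    and ractW :: "'w \<Rightarrow> 'a \<Rightarrow> 'w"
    and pair :: "'v \<Rightarrow> 'w \<Rightarrow> 'a"
  assumes add_left: "pair (x + y) w = pair x w + pair y w"
    and add_right: "pair x (w + z) = pair x w + pair x z"
    and balanced: "pair (ractV x b) w = pair x (lactW b w)"
    and lact_pair: "pair (lactV a x) w = a * pair x w"
    and pair_ract: "pair x (ractW w a) = pair x w * a"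

section \<open>Morita contexts and generalized matrix algebras\<close>

record ('r, 'a, 'm, 'n, 'b) morita =
  scalA :: "'r \<Rightarrow> 'a \<Rightarrow> 'a"
  scalB :: "'r \<Rightarrow> 'b \<Rightarrow> 'b"
  scalM :: "'r \<Rightarrow> 'm \<Rightarrow> 'm"
  scalN :: "'r \<Rightarrow> 'n \<Rightarrow> 'n"
  lactM :: "'a \<Rightarrow> 'm \<Rightarrow> 'm"
  ractM :: "'m \<Rightarrow> 'b \<Rightarrow> 'm"
  lactN :: "'b \<Rightarrow> 'n \<Rightarrow> 'n"
  ractN :: "'n \<Rightarrow> 'a \<Rightarrow> 'n"
  pairMN :: "'m \<Rightarrow> 'n \<Rightarrow> 'a"
  pairNM :: "'n \<Rightarrow> 'm \<Rightarrow> 'b"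

locale morita_context =
  M: bimodule "scalA C" "scalB C" "scalM C" "lactM C" "ractM C" +
  N: bimodule "scalB C" "scalA C" "scalN C" "lactN C" "ractN C" +
  MN: bimodule_pairing "lactM C" "ractM C" "lactN C" "ractN C" "pairMN C" +
  NM: bimodule_pairing "lactN C" "ractN C" "lactM C" "ractM C" "pairNM C"
  for C :: "('r::ring_1, 'a::ring_1, 'm::ab_group_add, 'n::ab_group_add, 'b::ring_1) morita" +
  assumes MN_M: "lactM C (pairMN C x y) x' = ractM C x (pairNM C y x')"
    and NM_N: "lactN C (pairNM C y x) y' = ractN C y (pairMN C x y')"

text \<open>\<open>Gmat A M N B\<close> lists the entries row by row: \<open>A\<close>, \<open>M\<close> above \<open>N\<close>, \<open>B\<close>.\<close>

datatype ('a, 'm, 'n, 'b) gmat = Gmat (entA: 'a) (entM: 'm) (entN: 'n) (entB: 'b)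

instantiation gmat :: (ab_group_add, ab_group_add, ab_group_add, ab_group_add) ab_group_add
begin

definition "0 = Gmat 0 0 0 0"
definition "X + Y = Gmat (entA X + entA Y) (entM X + entM Y) (entN X + entN Y) (entB X + entB Y)"
definition "- X = Gmat (- entA X) (- entM X) (- entN X) (- entB X)"
definition "X - Y = Gmat (entA X - entA Y) (entM X - entM Y) (entN X - entN Y) (entB X - entB Y)"

instance
  by standard
    (simp_all add: zero_gmat_def plus_gmat_def uminus_gmat_def minus_gmat_def algebra_simps)

end

definition gmat_one :: "('a::ring_1, 'm::ab_group_add, 'n::ab_group_add, 'b::ring_1) gmat" where
  "gmat_one = Gmat 1 0 0 1"

definition gmat_scal ::
    "('r::ring_1, 'a::ring_1, 'm::ab_group_add, 'n::ab_group_add, 'b::ring_1) morita \<Rightarrow>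
     'r \<Rightarrow> ('a, 'm, 'n, 'b) gmat \<Rightarrow> ('a, 'm, 'n, 'b) gmat" where
  "gmat_scal C r X =
     Gmat (scalA C r (entA X)) (scalM C r (entM X)) (scalN C r (entN X)) (scalB C r (entB X))"

definition gmat_mult ::
    "('r::ring_1, 'a::ring_1, 'm::ab_group_add, 'n::ab_group_add, 'b::ring_1) morita \<Rightarrow>
     ('a, 'm, 'n, 'b) gmat \<Rightarrow> ('a, 'm, 'n, 'b) gmat \<Rightarrow> ('a, 'm, 'n, 'b) gmat" where
  "gmat_mult C X Y =
     Gmat (entA X * entA Y + pairMN C (entM X) (entN Y))
          (lactM C (entA X) (entM Y) + ractM C (entM X) (entB Y))
          (ractN C (entN X) (entA Y) + lactN C (entB X) (entN Y))
          (pairNM C (entN X) (entM Y) + entB X * entB Y)"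

lemma (in morita_context) gmat_mult_assoc:
  "gmat_mult C (gmat_mult C X Y) Z = gmat_mult C X (gmat_mult C Y Z)"
  by (simp add: gmat_mult_def algebra_simps M.L.act_add M.L.add_act M.L.mult_act M.R.act_add
      M.R.add_act M.R.act_mult N.L.act_add N.L.add_act N.L.mult_act N.R.act_add N.R.add_act
      N.R.act_mult M.lact_ract N.lact_ract MN.add_left MN.add_right MN.balanced MN.lact_pair
      MN.pair_ract NM.add_left NM.add_right NM.balanced NM.lact_pair NM.pair_ract MN_M NM_N)

lemma (in morita_context) gmat_mult_add_left:
  "gmat_mult C (X + Y) Z = gmat_mult C X Z + gmat_mult C Y Z"
  by (simp add: gmat_mult_def plus_gmat_def algebra_simps M.L.add_act M.R.add_act N.L.add_act
      N.R.add_act MN.add_left NM.add_left)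

lemma (in morita_context) gmat_mult_add_right:
  "gmat_mult C X (Y + Z) = gmat_mult C X Y + gmat_mult C X Z"
  by (simp add: gmat_mult_def plus_gmat_def algebra_simps M.L.act_add M.R.act_add N.L.act_add
      N.R.act_add MN.add_right NM.add_right)

lemma (in morita_context) gmat_mult_one:
  "gmat_mult C gmat_one X = X" "gmat_mult C X gmat_one = X"
proof -
  have "pairMN C 0 y = 0" "pairMN C x 0 = 0" "pairNM C 0 x = 0" "pairNM C y 0 = 0"
    "lactM C a 0 = 0" "lactM C 0 x = 0" "ractM C x 0 = 0" "ractM C 0 b = 0"
    "lactN C b 0 = 0" "lactN C 0 y = 0" "ractN C y 0 = 0" "ractN C 0 a = 0" for x y a b
    using MN.add_left[of 0 0 y] MN.add_right[of x 0 0] NM.add_left[of 0 0 x]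
      NM.add_right[of y 0 0] M.L.act_add[of a 0 0] M.L.add_act[of 0 0 x] M.R.act_add[of x 0 0]
      M.R.add_act[of 0 0 b] N.L.act_add[of b 0 0] N.L.add_act[of 0 0 y] N.R.act_add[of y 0 0]
      N.R.add_act[of 0 0 a] by simp_all
  then show "gmat_mult C gmat_one X = X" "gmat_mult C X gmat_one = X"
    by (simp_all add: gmat_mult_def gmat_one_def M.L.one_act M.R.act_one N.L.one_act N.R.act_one)
qed

section \<open>Integer multiples, characteristic, invertibility\<close>

text \<open>The integer multiple \<open>k x\<close>; at most one of the two sums is nonempty.\<close>

definition int_mult :: "int \<Rightarrow> 'v::ab_group_add \<Rightarrow> 'v" where
  "int_mult k x = (\<Sum>i<nat k. x) - (\<Sum>i<nat (- k). x)"

text \<open>``The characteristic is not \<open>k\<close>'' means here that there is no \<open>k\<close>-torsion.\<close>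

definition char_is_not :: "'v::ab_group_add itself \<Rightarrow> int \<Rightarrow> bool" where
  "char_is_not _ k \<longleftrightarrow> (\<forall>X::'v. int_mult k X = 0 \<longrightarrow> X = 0)"

definition invertible_elem :: "'a::ring_1 \<Rightarrow> bool" where
  "invertible_elem x \<longleftrightarrow> (\<exists>y. x * y = 1 \<and> y * x = 1)"

section \<open>Derivable mappings\<close>

definition gmat_linear ::
    "('r::ring_1, 'a::ring_1, 'm::ab_group_add, 'n::ab_group_add, 'b::ring_1) morita \<Rightarrow>
     (('a, 'm, 'n, 'b) gmat \<Rightarrow> ('a, 'm, 'n, 'b) gmat) \<Rightarrow> bool" where
  "gmat_linear C \<delta> \<longleftrightarrow>
     (\<forall>X Y. \<delta> (X + Y) = \<delta> X + \<delta> Y) \<and> (\<forall>r X. \<delta> (gmat_scal C r X) = gmat_scal C r (\<delta> X))"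

definition mn_derivable_at ::
    "('r::ring_1, 'a::ring_1, 'm::ab_group_add, 'n::ab_group_add, 'b::ring_1) morita \<Rightarrow>
     int \<Rightarrow> int \<Rightarrow> (('a, 'm, 'n, 'b) gmat \<Rightarrow> ('a, 'm, 'n, 'b) gmat) \<Rightarrow>
     ('a, 'm, 'n, 'b) gmat \<Rightarrow> bool" where
  "mn_derivable_at C m n \<delta> Z \<longleftrightarrow>
     gmat_linear C \<delta> \<and>
     (\<forall>S T. gmat_mult C S T = Z \<longrightarrow>
        int_mult m (\<delta> (gmat_mult C S T)) + int_mult n (\<delta> (gmat_mult C T S)) =
        int_mult m (gmat_mult C (\<delta> S) T) + int_mult m (gmat_mult C S (\<delta> T)) +
        int_mult n (gmat_mult C (\<delta> T) S) + int_mult n (gmat_mult C T (\<delta> S)))"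

definition jordan_derivation ::
    "('r::ring_1, 'a::ring_1, 'm::ab_group_add, 'n::ab_group_add, 'b::ring_1) morita \<Rightarrow>
     (('a, 'm, 'n, 'b) gmat \<Rightarrow> ('a, 'm, 'n, 'b) gmat) \<Rightarrow> bool" where
  "jordan_derivation C \<delta> \<longleftrightarrow>
     gmat_linear C \<delta> \<and>
     (\<forall>S T. \<delta> (gmat_mult C S T + gmat_mult C T S) =
        gmat_mult C (\<delta> S) T + gmat_mult C S (\<delta> T) +
        gmat_mult C (\<delta> T) S + gmat_mult C T (\<delta> S))"

end

theory Submission
  imports Defs "HOL.Modules"
begin

text \<open>
  Only pairs \<open>S, T\<close> with \<open>ST = TS = I\<close> are needed. Adding the identities for \<open>(S, T)\<close> and
  \<open>(T, S)\<close> and cancelling \<open>m + n\<close> leaves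
  \<open>\<delta>(S) T + T \<delta>(S) + S \<delta>(T) + \<delta>(T) S = 0\<close>, in which \<open>m\<close> and \<open>n\<close> no longer occur.
  For the involution \<open>diag(1, -1)\<close> this says that \<open>\<delta>(diag(1, 0))\<close> is off-diagonal, so subtracting
  an inner derivation makes it vanish. Invertible \<open>diag(a, t)\<close> with \<open>t = 1, -1, 2\<close> then show that
  \<open>\<delta>\<close> preserves the corners \<open>A\<close> and \<open>B\<close>, and \<open>diag(1, \<plusminus>1) + x\<close> with \<open>x\<close> in \<open>M\<close> that \<open>\<delta>(x)\<close> is
  off-diagonal with \<open>x \<delta>(x) + \<delta>(x) x = 0\<close>. Block triangular elements give
  \<open>\<delta>(a x) = a \<delta>(x) + \<delta>(a) x + \<delta>(x) a\<close>, and \<open>(1 + x)(1 + y)\<close> with \<open>y\<close> in \<open>N\<close> gives the Jordan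
  identity for \<open>x, y\<close>. Faithfulness of \<open>M\<close> makes \<open>\<delta>\<close> a derivation on \<open>A\<close> and \<open>B\<close>.
\<close>

section \<open>Elementary consequences of the module and pairing axioms\<close>

lemma (in left_module) act_zero [simp]: "act r 0 = 0"
  using act_add[of r 0 0] by simp

lemma (in left_module) zero_act [simp]: "act 0 x = 0"
  using add_act[of 0 0 x] by simp

lemma (in left_module) act_minus [simp]: "act r (- x) = - act r x"
  using act_add[of r x "- x"] by (simp add: eq_neg_iff_add_eq_0 add.commute)

lemma (in left_module) minus_act [simp]: "act (- r) x = - act r x"
  using add_act[of r "- r" x] by (simp add: eq_neg_iff_add_eq_0 add.commute)

lemma (in left_module) diff_act: "act (r - s) x = act r x - act s x"
  using add_act[of "r - s" s x] by (simp add: eq_diff_eq)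

lemma (in right_module) act_diff: "act x (r - s) = act x r - act x s"
  using act_add[of x "r - s" s] by (simp add: eq_diff_eq)

lemma (in right_module) act_zero [simp]: "act x 0 = 0"
  using act_add[of x 0 0] by simp

lemma (in right_module) zero_act [simp]: "act 0 r = 0"
  using add_act[of 0 0 r] by simp

lemma (in right_module) act_minus [simp]: "act x (- r) = - act x r"
  using act_add[of x r "- r"] by (simp add: eq_neg_iff_add_eq_0 add.commute)

lemma (in right_module) minus_act [simp]: "act (- x) r = - act x r"
  using add_act[of x "- x" r] by (simp add: eq_neg_iff_add_eq_0 add.commute)

lemma (in bimodule_pairing) pair_zero_left [simp]: "pair 0 w = 0"
  using add_left[of 0 0 w] by simp

lemma (in bimodule_pairing) pair_zero_right [simp]: "pair x 0 = 0"
  using add_right[of x 0 0] by simp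

lemma (in bimodule_pairing) pair_minus_left [simp]: "pair (- x) w = - pair x w"
  using add_left[of x "- x" w] by (simp add: eq_neg_iff_add_eq_0 add.commute)

lemma (in bimodule_pairing) pair_minus_right [simp]: "pair x (- w) = - pair x w"
  using add_right[of x w "- w"] by (simp add: eq_neg_iff_add_eq_0 add.commute)

lemma (in bimodule_pairing) pair_diff_left: "pair (x - y) w = pair x w - pair y w"
  using add_left[of "x - y" y w] by (simp add: eq_diff_eq)

lemma (in bimodule_pairing) pair_diff_right: "pair x (w - z) = pair x w - pair x z"
  using add_right[of x "w - z" z] by (simp add: eq_diff_eq)

lemma gmat_sel_simps [simp]:
  "entA 0 = 0" "entM 0 = 0" "entN 0 = 0" "entB 0 = 0"
  "entA (X + Y) = entA X + entA Y" "entM (X + Y) = entM X + entM Y"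
  "entN (X + Y) = entN X + entN Y" "entB (X + Y) = entB X + entB Y"
  by (simp_all add: zero_gmat_def plus_gmat_def)

section \<open>Integer multiples, torsion and generation by invertible elements\<close>

lemma int_mult_zero [simp]: "int_mult k 0 = 0"
  by (simp add: int_mult_def)

text \<open>Since \<open>nat\<close> truncates at \<open>0\<close>, passing from \<open>k\<close> to
  \<open>k + 1\<close> either lengthens the first sum or shortens the second; hence the split by
  sign.\<close>

lemma int_mult_plus_one: "int_mult (k + 1) X = int_mult k X + X"
proof (cases "k \<ge> 0")
  case True
  then have "nat (k + 1) = Suc (nat k)" "nat (- k) = 0" "nat (- (k + 1)) = 0"
    by simp_all
  then show ?thesis
    unfolding int_mult_def by simp
next
  case False
  then have "nat (- k) = Suc (nat (- (k + 1)))" "nat k = 0" "nat (k + 1) = 0"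
    by simp_all
  then show ?thesis
    unfolding int_mult_def by simp
qed

lemma int_mult_minus_one: "int_mult (k - 1) X = int_mult k X - X"
  using int_mult_plus_one[of "k - 1" X] by (simp add: eq_diff_eq)

lemma int_mult_0 [simp]: "int_mult 0 X = 0"
  by (simp add: int_mult_def)

lemma int_mult_1: "int_mult 1 X = X"
  by (simp add: int_mult_def)

lemma int_mult_add: "int_mult k (X + Y) = int_mult k X + int_mult k Y"
  by (simp add: int_mult_def sum.distrib algebra_simps)

lemma int_mult_add_left: "int_mult (k + l) X = int_mult k X + int_mult l X"
proof (induction l rule: int_induct[where k = 0])
  case (step1 i)
  then show ?case
    using int_mult_plus_one[of "k + i" X] int_mult_plus_one[of i X] by (simp add: add.assoc)
next
  case (step2 i)
  then show ?case
    using int_mult_minus_one[of "k + i" X] int_mult_minus_one[of i X] by (simp add: add_diff_eq)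
qed simp

lemma int_mult_mult: "int_mult (k * l) X = int_mult k (int_mult l X)"
proof (induction k rule: int_induct[where k = 0])
  case (step1 i)
  then show ?case
    by (simp add: distrib_right int_mult_add_left int_mult_1)
next
  case (step2 i)
  then show ?case
    using int_mult_add_left[of "(i - 1) * l" l X]
    by (simp add: int_mult_minus_one algebra_simps)
qed simp

lemma int_mult_3: "int_mult 3 X = X + X + X"
  by (simp add: int_mult_def numeral_3_eq_3 add.assoc)

text \<open>What \<open>k\<close> kills is killed by every multiple of \<open>k\<close>. In this way
  the single condition on \<open>3 m n (m + n)\<close> excludes both \<open>3\<close>-torsion and
  \<open>(m + n)\<close>-torsion.\<close>

lemma char_is_not_dvd:
  fixes X :: "'v::ab_group_add"
  assumes "char_is_not TYPE('v) l" "k dvd l" "int_mult k X = 0"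
  shows "X = 0"
proof -
  obtain j where "l = j * k"
    using \<open>k dvd l\<close> by (metis dvd_def mult.commute)
  then have "int_mult l X = 0"
    using \<open>int_mult k X = 0\<close> by (simp add: int_mult_mult)
  then show ?thesis
    using assms(1) by (simp add: char_is_not_def)
qed

text \<open>Every \<open>a\<close> is the invertible element \<open>of_int k + a\<close> minus an
  integer, and the integers arise from \<open>1\<close> by differences. Identities additive in
  \<open>a\<close> thus need checking only for invertible \<open>a\<close>.\<close>

lemma shift_invertible_induct [case_names shift diff invertible]:
  fixes a :: "'a::ring_1"
  assumes shift: "\<And>a::'a. \<exists>k::int. invertible_elem (of_int k + a)"
    and diff: "\<And>a b. P a \<Longrightarrow> P b \<Longrightarrow> P (a - b)"
    and inv: "\<And>a a'. a * a' = 1 \<Longrightarrow> a' * a = 1 \<Longrightarrow> P a"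
  shows "P a"
proof -
  have "P 1"
    by (rule inv) simp_all
  have "P 0"
    using diff[OF \<open>P 1\<close> \<open>P 1\<close>] by simp
  have "P (of_int k)" for k
  proof (induction k rule: int_induct[where k = 0])
    case (step1 i)
    then show ?case
      \<comment> \<open>Only differences are available, so \<open>i + 1\<close> is reached as
        \<open>i - (0 - 1)\<close>.\<close>
      using diff[OF _ diff[OF \<open>P 0\<close> \<open>P 1\<close>]]
      by (metis diff_0 diff_minus_eq_add of_int_add of_int_1)
  next
    case (step2 i)
    then show ?case
      using diff[OF _ \<open>P 1\<close>] by simp
  qed (simp add: \<open>P 0\<close>)
  moreover obtain k :: int where "P (of_int k + a)"
    using shift[of a] inv by (auto simp: invertible_elem_def)
  ultimately show ?thesis
    using diff[of "of_int k + a" "of_int k"] by simp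
qed

lemma invertible_two_torsion_free:
  fixes x :: "'a::ring_1"
  assumes "invertible_elem (2::'a)" "x + x = 0"
  shows "x = 0"
  using assms unfolding invertible_elem_def mult_2[symmetric]
  by (metis mult.assoc mult_1 mult_zero_right)

lemma (in left_module) two_torsion_free:
  fixes x :: 'v
  assumes "invertible_elem (2::'r)" "x + x = 0"
  shows "x = 0"
proof -
  obtain h :: 'r where "h * 2 = 1"
    using assms(1) by (auto simp: invertible_elem_def)
  then have "x = act h (act 2 x)"
    by (metis mult_act one_act)
  also have "act 2 x = x + x"
    using add_act[of 1 1 x] by (simp add: one_act)
  finally show ?thesis
    using assms(2) by simp
qed

text \<open>With \<open>h\<close> a half, the second assumption says \<open>h x = 2 x\<close>;
  doubling gives \<open>x = 4 x\<close>.\<close>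

lemma (in left_module) double_half:
  assumes "2 * h = 1" "act h x + act 2 (- x) = 0"
  shows "x + x + x = 0"
proof -
  have "act 2 (act h x) = act 2 (act 2 x)"
    using assms(2) by simp
  then have "x = act (1 + 1 + 1 + 1) x"
    using assms(1) by (simp add: mult_act[symmetric] one_act)
  then show ?thesis
    unfolding add_act one_act by simp
qed

lemma (in right_module) double_half:
  assumes "h * 2 = 1" "act x h + act (- x) 2 = 0"
  shows "x + x + x = 0"
proof -
  have "act (act x h) 2 = act (act x 2) 2"
    using assms(2) by simp
  then have "x = act x (1 + 1 + 1 + 1)"
    using assms(1) by (simp add: act_mult[symmetric] act_one)
  then show ?thesis
    unfolding act_add act_one by simp
qed

text \<open>
  Through this symmetry, statements about \<open>A\<close> and \<open>M\<close> yield the statements about \<open>B\<close> and \<open>N\<close>.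
\<close>

definition swap_context ::
    "('r::ring_1, 'a::ring_1, 'm::ab_group_add, 'n::ab_group_add, 'b::ring_1) morita \<Rightarrow>
     ('r, 'b, 'n, 'm, 'a) morita" where
  "swap_context C =
     \<lparr>scalA = scalB C, scalB = scalA C, scalM = scalN C, scalN = scalM C,
      lactM = lactN C, ractM = ractN C, lactN = lactM C, ractN = ractM C,
      pairMN = pairNM C, pairNM = pairMN C\<rparr>"

definition swap_gmat :: "('a, 'm, 'n, 'b) gmat \<Rightarrow> ('b, 'n, 'm, 'a) gmat" where
  "swap_gmat X = Gmat (entB X) (entN X) (entM X) (entA X)"

lemma swap_gmat_simps [simp]:
  "swap_gmat (Gmat a x y b) = Gmat b y x a"
  "swap_gmat (swap_gmat X) = X"
  "entA (swap_gmat X) = entB X" "entM (swap_gmat X) = entN X"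
  "entN (swap_gmat X) = entM X" "entB (swap_gmat X) = entA X"
  by (simp_all add: swap_gmat_def)

lemma swap_gmat_zero [simp]: "swap_gmat 0 = 0"
  by (simp add: swap_gmat_def zero_gmat_def)

lemma swap_gmat_one [simp]: "swap_gmat gmat_one = gmat_one"
  by (simp add: swap_gmat_def gmat_one_def)

lemma swap_gmat_add: "swap_gmat (X + Y) = swap_gmat X + swap_gmat Y"
  by (simp add: swap_gmat_def plus_gmat_def)

text \<open>The exchange is conjugation by a permutation matrix, so factors keep their order and no
  opposite algebra appears.\<close>

lemma swap_gmat_mult:
  "swap_gmat (gmat_mult C X Y) = gmat_mult (swap_context C) (swap_gmat X) (swap_gmat Y)"
  by (simp add: swap_gmat_def gmat_mult_def swap_context_def add.commute)

lemma swap_gmat_eq_iff: "swap_gmat X = Y \<longleftrightarrow> X = swap_gmat Y"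
  by auto

lemma morita_context_swap: "morita_context C \<Longrightarrow> morita_context (swap_context C)"
  unfolding morita_context_def morita_context_axioms_def swap_context_def by simp

context morita_context
begin

text \<open>Supplies distributivity, also over differences, to \<open>algebra_simps\<close> for
  \<open>gmat_mult C\<close>.\<close>

sublocale U: ring "(+)" 0 "(-)" uminus "gmat_mult C"
  by unfold_locales (simp_all add: gmat_mult_assoc gmat_mult_add_left gmat_mult_add_right)

declare M.L.one_act [simp] M.R.act_one [simp] N.L.one_act [simp] N.R.act_one [simp]

lemmas action_simps = M.L.act_add M.L.add_act M.L.mult_act[symmetric]
  M.R.act_add M.R.add_act M.R.act_mult[symmetric]
  N.L.act_add N.L.add_act N.L.mult_act[symmetric]
  N.R.act_add N.R.add_act N.R.act_mult[symmetric]
  MN.add_left MN.add_right NM.add_left NM.add_right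

end

section \<open>Additive mappings with the Jordan identity at mutually inverse pairs\<close>

locale jordan_at_inverses = morita_context C
  for C :: "('r::ring_1, 'a::ring_1, 'm::ab_group_add, 'n::ab_group_add, 'b::ring_1) morita" +
  fixes \<delta> :: "('a, 'm, 'n, 'b) gmat \<Rightarrow> ('a, 'm, 'n, 'b) gmat"
  assumes additive: "\<delta> (X + Y) = \<delta> X + \<delta> Y"
    and at_inverse: "gmat_mult C S T = gmat_one \<Longrightarrow> gmat_mult C T S = gmat_one \<Longrightarrow>
       gmat_mult C (\<delta> S) T + gmat_mult C T (\<delta> S) + gmat_mult C S (\<delta> T) + gmat_mult C (\<delta> T) S = 0"
    and half_A: "invertible_elem (2::'a)"
    and half_B: "invertible_elem (2::'b)"
begin

sublocale \<delta>: additive \<delta>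
  by unfold_locales (rule additive)

text \<open>The halves in \<open>A\<close> and \<open>B\<close> act from the left on
  \<open>M\<close> and \<open>N\<close>, so all four entries can be halved.\<close>

lemma two_torsion_free:
  "a + a = 0 \<Longrightarrow> a = 0" "x + x = 0 \<Longrightarrow> x = 0" "y + y = 0 \<Longrightarrow> y = 0" "b + b = 0 \<Longrightarrow> b = 0"
  for a :: 'a and x :: 'm and y :: 'n and b :: 'b
  using half_A half_B
  by (blast intro: invertible_two_torsion_free M.L.two_torsion_free N.L.two_torsion_free)+

text \<open>Serves for equations that come in two versions, one for the scalar \<open>1\<close> and
  one for \<open>- 1\<close> in a corner: the sum of the two cancels the part that changes
  sign.\<close>

lemma zero_if_add_diff_zero:
  "x + z = 0 \<Longrightarrow> x - z = 0 \<Longrightarrow> x = 0" "y + w = 0 \<Longrightarrow> y - w = 0 \<Longrightarrow> y = 0"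
  for x z :: 'm and y w :: 'n
  by (auto dest: two_torsion_free)

lemma two_torsion_free_gmat:
  "X + X = 0 \<Longrightarrow> X = 0" for X :: "('a, 'm, 'n, 'b) gmat"
  by (cases X) (auto simp: plus_gmat_def zero_gmat_def dest: two_torsion_free)

lemma at_involution:
  assumes "gmat_mult C S S = gmat_one"
  shows "gmat_mult C (\<delta> S) S + gmat_mult C S (\<delta> S) = 0"
proof (rule two_torsion_free_gmat)
  show "gmat_mult C (\<delta> S) S + gmat_mult C S (\<delta> S) +
      (gmat_mult C (\<delta> S) S + gmat_mult C S (\<delta> S)) = 0"
    using at_inverse[OF assms assms] by (simp add: add_ac)
qed

lemma map_one: "\<delta> gmat_one = 0"
  using at_involution[of gmat_one] by (auto simp: gmat_mult_one dest: two_torsion_free_gmat)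

text \<open>The involution \<open>diag(1, -1)\<close> is \<open>2 e - 1\<close> for the corner unit
  \<open>e\<close>, and \<open>\<delta>\<close> kills \<open>1\<close>, so its image is
  \<open>2 \<delta>(e)\<close>. Anticommuting with the involution forces the diagonal entries to
  vanish.\<close>

lemma map_corner_unit: "\<exists>u v. \<delta> (Gmat 1 0 0 0) = Gmat 0 u v 0"
proof -
  let ?S = "Gmat 1 0 0 (- 1) :: ('a, 'm, 'n, 'b) gmat"
  obtain p u v q where e: "\<delta> (Gmat 1 0 0 0) = Gmat p u v q"
    by (cases "\<delta> (Gmat 1 0 0 0)")
  have "?S + gmat_one = Gmat 1 0 0 0 + Gmat 1 0 0 0"
    by (simp add: plus_gmat_def gmat_one_def)
  then have "\<delta> ?S = Gmat (p + p) (u + u) (v + v) (q + q)"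
    using additive[of ?S gmat_one] additive[of "Gmat 1 0 0 0" "Gmat 1 0 0 0"]
    by (simp add: map_one e) (simp add: plus_gmat_def)
  moreover have "gmat_mult C ?S ?S = gmat_one"
    by (simp add: gmat_mult_def gmat_one_def)
  ultimately have "p + p + (p + p) = 0" "- (q + q) + - (q + q) = 0"
    using at_involution[of ?S]
    by (simp_all add: gmat_mult_def plus_gmat_def zero_gmat_def)
  then have "p + p = 0" "- (q + q) = 0"
    by (blast dest: two_torsion_free)+
  then have "p = 0" "q = 0"
    unfolding neg_equal_0_iff_equal by (blast dest: two_torsion_free)+
  then show ?thesis
    using e by blast
qed

end

text \<open>The shift condition is stated for each corner separately, which keeps the assumptions
  symmetric under exchange of the corners. The normalization \<open>map_e\<close> is achieved later
  by subtracting an inner derivation.\<close>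

locale normalized_jordan_at_inverses = jordan_at_inverses C \<delta>
  for C :: "('r::ring_1, 'a::ring_1, 'm::ab_group_add, 'n::ab_group_add, 'b::ring_1) morita"
    and \<delta> +
  assumes map_e: "\<delta> (Gmat 1 0 0 0) = 0"
    and three_torsion_free: "(X :: ('a, 'm, 'n, 'b) gmat) + X + X = 0 \<Longrightarrow> X = 0"
    and shift_A: "\<exists>k::int. invertible_elem (of_int k + (a::'a))"
    and shift_B: "\<exists>k::int. invertible_elem (of_int k + (b::'b))"
begin

text \<open>The two corner units add up to \<open>1\<close>. For the exchanged mapping this is the
  normalization \<open>map_e\<close>.\<close>

lemma map_f: "\<delta> (Gmat 0 0 0 1) = 0"
  using additive[of "Gmat 1 0 0 0" "Gmat 0 0 0 1"] map_one map_e
  by (simp add: plus_gmat_def gmat_one_def)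

lemma swapped: "normalized_jordan_at_inverses (swap_context C) (\<lambda>X. swap_gmat (\<delta> (swap_gmat X)))"
proof (rule normalized_jordan_at_inverses.intro[OF jordan_at_inverses.intro[OF
        morita_context_swap[OF morita_context_axioms] jordan_at_inverses_axioms.intro]
      normalized_jordan_at_inverses_axioms.intro])
  fix S T :: "('b, 'n, 'm, 'a) gmat"
  assume "gmat_mult (swap_context C) S T = gmat_one" "gmat_mult (swap_context C) T S = gmat_one"
  then have "gmat_mult C (swap_gmat S) (swap_gmat T) = gmat_one"
    "gmat_mult C (swap_gmat T) (swap_gmat S) = gmat_one"
    by (metis swap_gmat_mult swap_gmat_one swap_gmat_simps(2))+
  from arg_cong[OF at_inverse[OF this], of swap_gmat]
  show "gmat_mult (swap_context C) (swap_gmat (\<delta> (swap_gmat S))) T +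
      gmat_mult (swap_context C) T (swap_gmat (\<delta> (swap_gmat S))) +
      gmat_mult (swap_context C) S (swap_gmat (\<delta> (swap_gmat T))) +
      gmat_mult (swap_context C) (swap_gmat (\<delta> (swap_gmat T))) S = 0"
    by (simp add: swap_gmat_add swap_gmat_mult)
next
  fix X :: "('b, 'n, 'm, 'a) gmat"
  assume "X + X + X = 0"
  then have "swap_gmat X + swap_gmat X + swap_gmat X = 0"
    by (simp add: swap_gmat_add[symmetric])
  then have "swap_gmat X = 0"
    by (rule three_torsion_free)
  then show "X = 0"
    by (simp add: swap_gmat_eq_iff)
qed (simp_all add: additive swap_gmat_add half_A half_B map_f shift_A shift_B)

lemma three_torsion_free_entries:
  "x + x + x = 0 \<Longrightarrow> x = 0" "y + y + y = 0 \<Longrightarrow> y = 0" "b + b + b = 0 \<Longrightarrow> b = 0"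
  for x :: 'm and y :: 'n and b :: 'b
  using three_torsion_free[of "Gmat 0 x 0 0"] three_torsion_free[of "Gmat 0 0 y 0"]
    three_torsion_free[of "Gmat 0 0 0 b"]
  by (simp_all add: plus_gmat_def zero_gmat_def)

section \<open>Block form of the normalized mapping\<close>

lemma map_split:
  "\<delta> (Gmat a x y b) = \<delta> (Gmat a 0 0 0) + \<delta> (Gmat 0 x 0 0) + \<delta> (Gmat 0 0 y 0) + \<delta> (Gmat 0 0 0 b)"
  unfolding additive[symmetric] by (simp add: plus_gmat_def)

lemma map_add_B: "\<delta> (Gmat 0 0 0 (b + b')) = \<delta> (Gmat 0 0 0 b) + \<delta> (Gmat 0 0 0 b')"
  unfolding additive[symmetric] by (simp add: plus_gmat_def)

text \<open>As \<open>\<delta>\<close> kills the lower corners \<open>b\<close> and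
  \<open>b'\<close>, the unknown entries come from \<open>a\<close> and \<open>a'\<close> alone.
  Varying \<open>b\<close> therefore gives several linear equations for the same unknowns.\<close>

lemma at_diagonal_inverse:
  fixes a a' :: 'a and b b' :: 'b
  assumes "a * a' = 1" "a' * a = 1" "b * b' = 1" "b' * b = 1"
    and "\<delta> (Gmat 0 0 0 b) = 0" "\<delta> (Gmat 0 0 0 b') = 0"
    and X: "\<delta> (Gmat a 0 0 0) = Gmat p x y q" and X': "\<delta> (Gmat a' 0 0 0) = Gmat p' x' y' q'"
  shows "ractM C x b' + lactM C a' x + lactM C a x' + ractM C x' b = 0"
    and "ractN C y a' + lactN C b' y + lactN C b y' + ractN C y' a = 0"
    and "q * b' + b' * q + b * q' + q' * b = 0"
proof -
  have z: "\<delta> (Gmat 0 0 0 0) = 0"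
    using \<delta>.zero by (simp add: zero_gmat_def)
  have "\<delta> (Gmat a 0 0 b) = Gmat p x y q" "\<delta> (Gmat a' 0 0 b') = Gmat p' x' y' q'"
    using map_split[of a 0 0 b] map_split[of a' 0 0 b'] by (simp_all add: assms z)
  moreover have "gmat_mult C (Gmat a 0 0 b) (Gmat a' 0 0 b') = gmat_one"
    "gmat_mult C (Gmat a' 0 0 b') (Gmat a 0 0 b) = gmat_one"
    by (simp_all add: gmat_mult_def gmat_one_def assms)
  ultimately have "gmat_mult C (Gmat p x y q) (Gmat a' 0 0 b') +
      gmat_mult C (Gmat a' 0 0 b') (Gmat p x y q) +
      gmat_mult C (Gmat a 0 0 b) (Gmat p' x' y' q') +
      gmat_mult C (Gmat p' x' y' q') (Gmat a 0 0 b) = 0"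
    using at_inverse by metis
  then show "ractM C x b' + lactM C a' x + lactM C a x' + ractM C x' b = 0"
    and "ractN C y a' + lactN C b' y + lactN C b y' + ractN C y' a = 0"
    and "q * b' + b' * q + b * q' + q' * b = 0"
    by (simp_all add: gmat_mult_def plus_gmat_def zero_gmat_def)
qed

text \<open>
  Comparing the scalars \<open>1\<close>, \<open>- 1\<close> and \<open>2\<close> in the other corner: if \<open>x\<close>, \<open>x'\<close> are corresponding
  entries of the images of \<open>a\<close> and \<open>a\<^sup>-\<^sup>1\<close>, then \<open>x + x' = 0\<close> and \<open>x / 2 + 2 x' = 0\<close>, so \<open>3 x' = 0\<close>.
\<close>

lemma map_A_invertible:
  fixes a a' :: 'a
  assumes "a * a' = 1" "a' * a = 1"
  shows "\<exists>p. \<delta> (Gmat a 0 0 0) = Gmat p 0 0 0"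
proof -
  obtain h :: 'b where h: "2 * h = 1" "h * 2 = 1"
    using half_B by (auto simp: invertible_elem_def)
  have hh: "h + h = 1"
    using h by (simp add: mult_2)
  obtain p x y q where X: "\<delta> (Gmat a 0 0 0) = Gmat p x y q"
    by (cases "\<delta> (Gmat a 0 0 0)")
  obtain p' x' y' q' where X': "\<delta> (Gmat a' 0 0 0) = Gmat p' x' y' q'"
    by (cases "\<delta> (Gmat a' 0 0 0)")
  have m: "\<delta> (Gmat 0 0 0 (- 1)) = 0"
    using \<delta>.minus[of "Gmat 0 0 0 1"] map_f by (simp add: uminus_gmat_def zero_gmat_def)
  have t: "\<delta> (Gmat 0 0 0 2) = 0"
    using map_add_B[of 1 1] map_f by simp
  have d: "\<delta> (Gmat 0 0 0 h) = 0"
    by (rule two_torsion_free_gmat) (simp add: map_add_B[symmetric] hh map_f)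
  note E1 = at_diagonal_inverse[OF assms, of 1 1, OF _ _ map_f map_f X X']
  note Em = at_diagonal_inverse[OF assms, of "- 1" "- 1", OF _ _ m m X X']
  note E2 = at_diagonal_inverse[OF assms h t d X X']
  \<comment> \<open>Passing from the scalar \<open>1\<close> to \<open>- 1\<close> leaves the terms
    with \<open>a\<close> and \<open>a'\<close> unchanged, so they drop out of the
    difference.\<close>
  have "(x + x') + (x + x') = (x + lactM C a' x + lactM C a x' + x') -
      (- x + lactM C a' x + lactM C a x' - x')"
    by simp
  also have "\<dots> = 0"
    using E1(1) Em(1) by simp
  finally have "x + x' = 0"
    by (rule two_torsion_free)
  then have x': "x' = - x"
    by (simp add: eq_neg_iff_add_eq_0 add.commute)
  then have "lactM C a' x + lactM C a x' = 0"
    using E1(1) by (simp add: add_ac)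
  moreover have "(lactM C a' x + lactM C a x') + (ractM C x h + ractM C x' 2) = 0"
    using E2(1) by (simp add: add_ac)
  ultimately have "ractM C x h + ractM C x' 2 = 0"
    by simp
  then have "x = 0"
    using h(2) x' M.R.double_half three_torsion_free_entries(1) by blast
  have "(y + y') + (y + y') = (ractN C y a' + y + y' + ractN C y' a) -
      (ractN C y a' - y - y' + ractN C y' a)"
    by simp
  also have "\<dots> = 0"
    using E1(2) Em(2) by simp
  finally have "y + y' = 0"
    by (rule two_torsion_free)
  then have y': "y' = - y"
    by (simp add: eq_neg_iff_add_eq_0 add.commute)
  then have "ractN C y a' + ractN C y' a = 0"
    using E1(2) by (simp add: add_ac)
  moreover have "(ractN C y a' + ractN C y' a) + (lactN C h y + lactN C 2 y') = 0"
    using E2(2) by (simp add: add_ac)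
  ultimately have "lactN C h y + lactN C 2 y' = 0"
    by simp
  then have "y = 0"
    using h(1) y' N.L.double_half three_torsion_free_entries(2) by blast
  \<comment> \<open>The \<open>B\<close> entry contains neither \<open>a\<close> nor
    \<open>a'\<close>, so the scalar \<open>1\<close> alone gives \<open>q' = - q\<close>.\<close>
  have "(q + q') + (q + q') = 0"
    using E1(3) by (simp add: add_ac)
  then have "q + q' = 0"
    by (rule two_torsion_free)
  then have q': "q' = - q"
    by (simp add: eq_neg_iff_add_eq_0 add.commute)
  have "q * h + h * q = - (2 * q' + q' * 2)"
    using E2(3) by (simp only: eq_neg_iff_add_eq_0 add.assoc)
  then have "q * h + h * q = (q + q) + (q + q)"
    by (simp add: q' mult_2 mult_2_right)
  \<comment> \<open>Doubling turns \<open>q h + h q = 4 q\<close> into \<open>2 q = 8 q\<close>;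
    what remains is \<open>6 q = 0\<close>, from which \<open>3\<close> and \<open>2\<close> are
    cancelled.\<close>
  then have "q * (h + h) + (h + h) * q = ((q + q) + (q + q)) + ((q + q) + (q + q))"
    unfolding distrib_left distrib_right by (metis add.assoc add.commute)
  then have "(q + q) + (q + q) + (q + q) = 0"
    by (simp add: hh add.assoc)
  then have "q = 0"
    using three_torsion_free_entries(3) two_torsion_free(4) by blast
  show ?thesis
    using X \<open>x = 0\<close> \<open>y = 0\<close> \<open>q = 0\<close> by blast
qed

text \<open>The matrix of \<open>\<delta>\<close> with respect to the four corners. The capital
  letter is the source; in the off-diagonal components the small letter is the target.\<close>

definition "dA a = entA (\<delta> (Gmat a 0 0 0))"
definition "dB b = entB (\<delta> (Gmat 0 0 0 b))"
definition "mM x = entM (\<delta> (Gmat 0 x 0 0))"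
definition "nM x = entN (\<delta> (Gmat 0 x 0 0))"
definition "mN y = entM (\<delta> (Gmat 0 0 y 0))"
definition "nN y = entN (\<delta> (Gmat 0 0 y 0))"

lemma map_A: "\<delta> (Gmat a 0 0 0) = Gmat (dA a) 0 0 0"
proof -
  have "\<exists>p. \<delta> (Gmat a 0 0 0) = Gmat p 0 0 0"
  proof (induction a rule: shift_invertible_induct)
    case (diff a a')
    then show ?case
      using \<delta>.diff[of "Gmat a 0 0 0" "Gmat a' 0 0 0"] by (auto simp: minus_gmat_def)
  qed (blast intro: shift_A map_A_invertible)+
  then show ?thesis
    by (auto simp: dA_def)
qed

text \<open>For the inverse pair \<open>1 + x\<close>, \<open>1 - x\<close> the identity reduces to
  \<open>2 (x D + D x) = 0\<close> with \<open>D = \<delta>(x)\<close>; its diagonal entries are the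
  two pairings. The involution \<open>diag(1, -1) + x\<close> then makes the diagonal of
  \<open>D\<close> vanish.\<close>

lemma map_M_and_pair:
  "\<delta> (Gmat 0 x 0 0) = Gmat 0 (mM x) (nM x) 0 \<and> pairMN C x (nM x) = 0 \<and> pairNM C (nM x) x = 0"
proof -
  obtain p u v q where X: "\<delta> (Gmat 0 x 0 0) = Gmat p u v q"
    by (cases "\<delta> (Gmat 0 x 0 0)")
  have X': "\<delta> (Gmat 0 (- x) 0 0) = - Gmat p u v q"
    using \<delta>.minus[of "Gmat 0 x 0 0"] by (simp add: X uminus_gmat_def)
  have m: "\<delta> (Gmat 0 0 0 (- 1)) = 0"
    using \<delta>.minus[of "Gmat 0 0 0 1"] map_f by (simp add: uminus_gmat_def zero_gmat_def)
  have z: "\<delta> (Gmat 0 0 0 0) = 0"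
    using \<delta>.zero by (simp add: zero_gmat_def)
  have S: "\<delta> (Gmat 1 x 0 1) = Gmat p u v q" "\<delta> (Gmat 1 (- x) 0 1) = - Gmat p u v q"
    "\<delta> (Gmat 1 x 0 (- 1)) = Gmat p u v q"
    using map_split[of 1 x 0 1] map_split[of 1 "- x" 0 1] map_split[of 1 x 0 "- 1"]
    by (simp_all add: X X' m z map_e map_f)
  have "- pairMN C x v = pairMN C x v" "- pairNM C v x = pairNM C v x"
    using at_inverse[of "Gmat 1 x 0 1" "Gmat 1 (- x) 0 1"]
    by (simp_all add: S gmat_mult_def gmat_one_def plus_gmat_def zero_gmat_def uminus_gmat_def)
  then have "pairMN C x v + pairMN C x v = 0" "pairNM C v x + pairNM C v x = 0"
    by (metis add.left_inverse)+
  then have v: "pairMN C x v = 0" "pairNM C v x = 0"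
    by (blast dest: two_torsion_free)+
  have "p + p = 0" "- q = q"
    using at_involution[of "Gmat 1 x 0 (- 1)"]
    by (simp_all add: S v gmat_mult_def gmat_one_def plus_gmat_def zero_gmat_def)
  moreover have "q + q = 0"
    using \<open>- q = q\<close> by (metis add.left_inverse)
  ultimately have "p = 0" "q = 0"
    by (blast dest: two_torsion_free)+
  then show ?thesis
    using X v by (simp add: mM_def nM_def)
qed

lemmas map_M = map_M_and_pair[THEN conjunct1]
  and pair_nM_self = map_M_and_pair[THEN conjunct2, THEN conjunct1] map_M_and_pair[THEN conjunct2, THEN conjunct2]

lemma map_B: "\<delta> (Gmat 0 0 0 b) = Gmat 0 0 0 (dB b)"
proof -
  interpret S: normalized_jordan_at_inverses "swap_context C" "\<lambda>X. swap_gmat (\<delta> (swap_gmat X))"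
    by (rule swapped)
  show ?thesis
    using S.map_A[of b] by (simp add: S.dA_def dB_def swap_gmat_eq_iff)
qed

lemma map_N_and_pair:
  "\<delta> (Gmat 0 0 y 0) = Gmat 0 (mN y) (nN y) 0 \<and> pairNM C y (mN y) = 0 \<and> pairMN C (mN y) y = 0"
proof -
  interpret S: normalized_jordan_at_inverses "swap_context C" "\<lambda>X. swap_gmat (\<delta> (swap_gmat X))"
    by (rule swapped)
  show ?thesis
    using S.map_M_and_pair[of y]
    by (simp add: S.mM_def S.nM_def mN_def nN_def swap_gmat_eq_iff swap_context_def)
qed

lemmas map_N = map_N_and_pair[THEN conjunct1]
  and pair_mN_self = map_N_and_pair[THEN conjunct2, THEN conjunct1] map_N_and_pair[THEN conjunct2, THEN conjunct2]

lemma map_Gmat: "\<delta> (Gmat a x y b) = Gmat (dA a) (mM x + mN y) (nM x + nN y) (dB b)"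
  using map_split[of a x y b] by (simp add: map_A map_B map_M map_N plus_gmat_def)

section \<open>Product rules for the components\<close>

lemma component_add:
  "dA (a + a') = dA a + dA a'" "dB (b + b') = dB b + dB b'"
  "mM (x + x') = mM x + mM x'" "nM (x + x') = nM x + nM x'"
  "mN (y + y') = mN y + mN y'" "nN (y + y') = nN y + nN y'"
  unfolding dA_def dB_def mM_def nM_def mN_def nN_def gmat_sel_simps(5-8)[symmetric]
    additive[symmetric]
  by (simp_all add: plus_gmat_def)

lemma component_zero [simp]:
  "dA 0 = 0" "dB 0 = 0" "mM 0 = 0" "nM 0 = 0" "mN 0 = 0" "nN 0 = 0"
  using component_add(1)[of 0 0] component_add(2)[of 0 0] component_add(3)[of 0 0]
    component_add(4)[of 0 0] component_add(5)[of 0 0] component_add(6)[of 0 0]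
  by simp_all

lemma component_minus [simp]: "mM (- x) = - mM x" "nM (- x) = - nM x"
  "mN (- y) = - mN y" "nN (- y) = - nN y"
  using component_add(3)[of x "- x"] component_add(4)[of x "- x"]
    component_add(5)[of y "- y"] component_add(6)[of y "- y"]
  by (simp_all add: eq_neg_iff_add_eq_0 add.commute)

lemma component_diff: "dA (a - a') = dA a - dA a'" "dB (b - b') = dB b - dB b'"
  "mM (x - x') = mM x - mM x'" "nM (x - x') = nM x - nM x'"
  using component_add(1)[of "a - a'" a'] component_add(2)[of "b - b'" b']
    component_add(3)[of "x - x'" x'] component_add(4)[of "x - x'" x']
  by (simp_all add: eq_diff_eq)

lemma dA_one: "dA 1 = 0" and dB_one: "dB 1 = 0"
  by (simp_all add: dA_def dB_def map_e map_f)

lemma dA_minus_one: "dA (- 1) = 0" and dB_minus_one: "dB (- 1) = 0"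
  using component_diff(1)[of 0 1] component_diff(2)[of 0 1] by (simp_all add: dA_one dB_one)

text \<open>In the \<open>M\<close> entry, changing the lower scalar from \<open>1\<close> to
  \<open>- 1\<close> keeps the terms of \<open>\<delta>(S) T + S \<delta>(T)\<close> and negates
  those of the reversed products; in the \<open>N\<close> entry the roles are exchanged. This is why
  \<open>nM\<close> turns the left action into a right action.\<close>

lemma map_lactM_invertible:
  assumes "a * a' = 1" "a' * a = 1"
  shows "mM (lactM C a x) = lactM C a (mM x) + lactM C (dA a) x"
    and "nM (lactM C a x) = ractN C (nM x) a"
proof -
  note [simp] = assms M.L.mult_act[symmetric]
  let ?y = "lactM C a x"
  \<comment> \<open>The entry \<open>a x\<close> is chosen so that the inverse has the entry
    \<open>- x\<close>, free of \<open>a'\<close>.\<close>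
  have 1: "gmat_mult C (Gmat a ?y 0 1) (Gmat a' (- x) 0 1) = gmat_one"
    "gmat_mult C (Gmat a' (- x) 0 1) (Gmat a ?y 0 1) = gmat_one"
    and 2: "gmat_mult C (Gmat a (- ?y) 0 (- 1)) (Gmat a' (- x) 0 (- 1)) = gmat_one"
    "gmat_mult C (Gmat a' (- x) 0 (- 1)) (Gmat a (- ?y) 0 (- 1)) = gmat_one"
    by (simp_all add: gmat_mult_def gmat_one_def)
  note E1 = at_inverse[OF 1, unfolded map_Gmat] and E2 = at_inverse[OF 2, unfolded map_Gmat]
  note [simp] = gmat_mult_def dA_one dB_one dA_minus_one dB_minus_one
  have "mM ?y - lactM C a (mM x) - lactM C (dA a) x
      + (lactM C a' (mM ?y) + lactM C (dA a') ?y - mM x) = 0"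
    using arg_cong[OF E1, of entM] by (simp add: algebra_simps)
  moreover have "mM ?y - lactM C a (mM x) - lactM C (dA a) x
      - (lactM C a' (mM ?y) + lactM C (dA a') ?y - mM x) = 0"
    using arg_cong[OF E2, of entM] by (simp add: algebra_simps)
  ultimately have "mM ?y - lactM C a (mM x) - lactM C (dA a) x = 0"
    by (rule zero_if_add_diff_zero)
  then show "mM ?y = lactM C a (mM x) + lactM C (dA a) x"
    by (simp add: algebra_simps)
  have "nM ?y - ractN C (nM x) a + (ractN C (nM ?y) a' - nM x) = 0"
    using arg_cong[OF E1, of entN] by (simp add: algebra_simps)
  moreover have "nM ?y - ractN C (nM x) a - (ractN C (nM ?y) a' - nM x) = 0"
    using arg_cong[OF E2, of entN] by (simp add: algebra_simps)
  ultimately have "nM ?y - ractN C (nM x) a = 0"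
    by (rule zero_if_add_diff_zero)
  then show "nM ?y = ractN C (nM x) a"
    by (simp add: algebra_simps)
qed

lemma map_lactM:
  "mM (lactM C a x) = lactM C a (mM x) + lactM C (dA a) x"
  "nM (lactM C a x) = ractN C (nM x) a"
proof -
  have "mM (lactM C a x) = lactM C a (mM x) + lactM C (dA a) x \<and>
      nM (lactM C a x) = ractN C (nM x) a"
  proof (induction a rule: shift_invertible_induct)
    case (diff a a')
    then show ?case
      by (simp add: M.L.diff_act N.R.act_diff component_diff)
  qed (simp_all add: shift_A map_lactM_invertible)
  then show "mM (lactM C a x) = lactM C a (mM x) + lactM C (dA a) x"
    "nM (lactM C a x) = ractN C (nM x) a"
    by simp_all
qed

text \<open>Exchanging the corners turns the left action on \<open>M\<close> into the one on
  \<open>N\<close>, so the right action on \<open>M\<close> has its own argument, with the scalars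
  \<open>1\<close> and \<open>- 1\<close> now in \<open>A\<close>.\<close>

lemma map_ractM_invertible:
  assumes "b * b' = 1" "b' * b = 1"
  shows "mM (ractM C x b) = ractM C (mM x) b + ractM C x (dB b)"
    and "nM (ractM C x b) = lactN C b (nM x)"
proof -
  note [simp] = assms M.R.act_mult[symmetric]
  let ?y = "ractM C x b"
  have 1: "gmat_mult C (Gmat 1 ?y 0 b) (Gmat 1 (- x) 0 b') = gmat_one"
    "gmat_mult C (Gmat 1 (- x) 0 b') (Gmat 1 ?y 0 b) = gmat_one"
    and 2: "gmat_mult C (Gmat (- 1) (- ?y) 0 b) (Gmat (- 1) (- x) 0 b') = gmat_one"
    "gmat_mult C (Gmat (- 1) (- x) 0 b') (Gmat (- 1) (- ?y) 0 b) = gmat_one"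
    by (simp_all add: gmat_mult_def gmat_one_def)
  note E1 = at_inverse[OF 1, unfolded map_Gmat] and E2 = at_inverse[OF 2, unfolded map_Gmat]
  note [simp] = gmat_mult_def dA_one dB_one dA_minus_one dB_minus_one
  have "mM ?y - ractM C (mM x) b - ractM C x (dB b)
      + (ractM C (mM ?y) b' + ractM C ?y (dB b') - mM x) = 0"
    using arg_cong[OF E1, of entM] by (simp add: algebra_simps)
  moreover have "mM ?y - ractM C (mM x) b - ractM C x (dB b)
      - (ractM C (mM ?y) b' + ractM C ?y (dB b') - mM x) = 0"
    using arg_cong[OF E2, of entM] by (simp add: algebra_simps)
  ultimately have "mM ?y - ractM C (mM x) b - ractM C x (dB b) = 0"
    by (rule zero_if_add_diff_zero)
  then show "mM ?y = ractM C (mM x) b + ractM C x (dB b)"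
    by (simp add: algebra_simps)
  have "nM ?y - lactN C b (nM x) + (lactN C b' (nM ?y) - nM x) = 0"
    using arg_cong[OF E1, of entN] by (simp add: algebra_simps)
  moreover have "nM ?y - lactN C b (nM x) - (lactN C b' (nM ?y) - nM x) = 0"
    using arg_cong[OF E2, of entN] by (simp add: algebra_simps)
  ultimately have "nM ?y - lactN C b (nM x) = 0"
    by (rule zero_if_add_diff_zero)
  then show "nM ?y = lactN C b (nM x)"
    by (simp add: algebra_simps)
qed

lemma map_ractM:
  "mM (ractM C x b) = ractM C (mM x) b + ractM C x (dB b)"
  "nM (ractM C x b) = lactN C b (nM x)"
proof -
  have "mM (ractM C x b) = ractM C (mM x) b + ractM C x (dB b) \<and>
      nM (ractM C x b) = lactN C b (nM x)"
  proof (induction b rule: shift_invertible_induct)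
    case (diff b b')
    then show ?case
      by (simp add: M.R.act_diff N.L.diff_act component_diff)
  qed (simp_all add: shift_B map_ractM_invertible)
  then show "mM (ractM C x b) = ractM C (mM x) b + ractM C x (dB b)"
    "nM (ractM C x b) = lactN C b (nM x)"
    by simp_all
qed

lemma map_lactN:
    "nN (lactN C b y) = lactN C b (nN y) + lactN C (dB b) y"
    "mN (lactN C b y) = ractM C (mN y) b"
  and map_ractN:
    "nN (ractN C y a) = ractN C (nN y) a + ractN C y (dA a)"
    "mN (ractN C y a) = lactM C a (mN y)"
proof -
  interpret S: normalized_jordan_at_inverses "swap_context C" "\<lambda>X. swap_gmat (\<delta> (swap_gmat X))"
    by (rule swapped)
  have "S.dA = dB" "S.dB = dA" "S.mM = nN" "S.nM = mN"
    by (simp_all add: fun_eq_iff S.dA_def S.dB_def S.mM_def S.nM_def dA_def dB_def mN_def nN_def)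
  then show "nN (lactN C b y) = lactN C b (nN y) + lactN C (dB b) y"
    "mN (lactN C b y) = ractM C (mN y) b"
    "nN (ractN C y a) = ractN C (nN y) a + ractN C y (dA a)"
    "mN (ractN C y a) = lactM C a (mN y)"
    using S.map_lactM[of b y] S.map_ractM[of y a] by (simp_all add: swap_context_def)
qed

text \<open>Here \<open>?S = (1 + x)(1 + y)\<close> and \<open>?T = (1 - y)(1 - x)\<close>. In the
  diagonal entries the pairings of \<open>x\<close> with \<open>nM x\<close> and of \<open>y\<close>
  with \<open>mN y\<close> vanish, and twice the product rule is left.\<close>

lemma map_pair:
  "dA (pairMN C x y) = pairMN C (mM x) y + pairMN C x (nN y)"
  "dB (pairNM C y x) = pairNM C (nN y) x + pairNM C y (mM x)"
proof -
  let ?S = "Gmat (1 + pairMN C x y) x y 1" and ?T = "Gmat 1 (- x) (- y) (1 + pairNM C y x)"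
  have "gmat_mult C ?S ?T = gmat_one" "gmat_mult C ?T ?S = gmat_one"
    by (simp_all add: gmat_mult_def gmat_one_def action_simps MN_M NM_N)
  note E = at_inverse[OF this, unfolded map_Gmat]
  note [simp] = gmat_mult_def dA_one dB_one component_add MN.add_left MN.add_right
    NM.add_left NM.add_right MN.pair_diff_left MN.pair_diff_right
    NM.pair_diff_left NM.pair_diff_right pair_nM_self pair_mN_self
  let ?p = "dA (pairMN C x y) - pairMN C (mM x) y - pairMN C x (nN y)"
  let ?q = "dB (pairNM C y x) - pairNM C (nN y) x - pairNM C y (mM x)"
  have "?p + ?p = 0"
    using arg_cong[OF E, of entA] by (simp add: algebra_simps)
  moreover have "?q + ?q = 0"
    using arg_cong[OF E, of entB] by (simp add: algebra_simps)
  ultimately have "?p = 0" "?q = 0"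
    by (blast dest: two_torsion_free)+
  then show "dA (pairMN C x y) = pairMN C (mM x) y + pairMN C x (nN y)"
    "dB (pairNM C y x) = pairNM C (nN y) x + pairNM C y (mM x)"
    by (simp_all add: algebra_simps)
qed

text \<open>Polarization of \<open>pair_nM_self\<close>.\<close>

lemma pair_nM_swap:
  "pairMN C x' (nM x) = - pairMN C x (nM x')" "pairNM C (nM x') x = - pairNM C (nM x) x'"
  using pair_nM_self[of "x + x'"] pair_nM_self[of x] pair_nM_self[of x']
  by (simp_all add: component_add MN.add_left MN.add_right NM.add_left NM.add_right
      eq_neg_iff_add_eq_0 add.commute)

lemma pair_mN_swap:
  "pairNM C y' (mN y) = - pairNM C y (mN y')" "pairMN C (mN y') y = - pairMN C (mN y) y'"
  using pair_mN_self[of "y + y'"] pair_mN_self[of y] pair_mN_self[of y']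
  by (simp_all add: component_add MN.add_left MN.add_right NM.add_left NM.add_right
      eq_neg_iff_add_eq_0 add.commute)

text \<open>Expanding \<open>mM\<close> on \<open>(a a') x\<close> in two ways shows that the defect
  of the product rule annihilates \<open>M\<close>; likewise on the right for
  \<open>B\<close>.\<close>

lemma derivation_corners:
  assumes "faithful_bimodule (lactM C) (ractM C)"
  shows "dA (a * a') = dA a * a' + a * dA a'" "dB (b * b') = dB b * b' + b * dB b'"
proof -
  have "lactM C (dA (a * a') - (dA a * a' + a * dA a')) x = 0" for x
    using map_lactM(1)[of "a * a'" x]
    by (simp add: M.L.diff_act M.L.add_act M.L.act_add M.L.mult_act map_lactM algebra_simps)
  moreover have "ractM C x (dB (b * b') - (dB b * b' + b * dB b')) = 0" for x
    using map_ractM(1)[of x "b * b'"]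
    by (simp add: M.R.act_diff M.R.add_act M.R.act_add M.R.act_mult map_ractM algebra_simps)
  ultimately show "dA (a * a') = dA a * a' + a * dA a'" "dB (b * b') = dB b * b' + b * dB b'"
    using assms unfolding faithful_bimodule_def by (metis eq_iff_diff_eq_0)+
qed

text \<open>The components \<open>nM\<close> and \<open>mN\<close> reverse products, which the
  symmetrized product absorbs. Their contributions to the diagonal cancel by the polarized
  identities.\<close>

lemma jordan:
  assumes "faithful_bimodule (lactM C) (ractM C)"
  shows "\<delta> (gmat_mult C S T + gmat_mult C T S) =
    gmat_mult C (\<delta> S) T + gmat_mult C S (\<delta> T) + gmat_mult C (\<delta> T) S + gmat_mult C T (\<delta> S)"
proof -
  obtain a x y b a' x' y' b' where "S = Gmat a x y b" "T = Gmat a' x' y' b'"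
    by (metis gmat.exhaust)
  then show ?thesis
    using pair_nM_swap[of x x'] pair_mN_swap[of y y']
    by (simp add: gmat_mult_def plus_gmat_def map_Gmat component_add derivation_corners[OF assms]
        map_pair map_lactM map_ractM map_lactN map_ractN MN.add_left MN.add_right
        NM.add_left NM.add_right M.L.act_add M.R.add_act N.L.act_add N.R.add_act algebra_simps)
qed

end

section \<open>Reduction to the normalized case\<close>

lemma (in morita_context) inner_jordan:
  fixes g :: "('a, 'm, 'n, 'b) gmat"
  defines "\<iota> \<equiv> \<lambda>X. gmat_mult C X g - gmat_mult C g X"
  shows "\<iota> (gmat_mult C S T + gmat_mult C T S) =
    gmat_mult C (\<iota> S) T + gmat_mult C S (\<iota> T) + gmat_mult C (\<iota> T) S + gmat_mult C T (\<iota> S)"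
  by (simp add: \<iota>_def algebra_simps gmat_mult_assoc)

lemma (in morita_context) jordan_at_inverses_if_derivable_at_one:
  fixes \<delta> :: "('a, 'm, 'n, 'b) gmat \<Rightarrow> ('a, 'm, 'n, 'b) gmat"
  assumes \<delta>: "mn_derivable_at C m n \<delta> gmat_one"
    and torsion: "\<And>X::('a, 'm, 'n, 'b) gmat. int_mult (m + n) X = 0 \<Longrightarrow> X = 0"
    and "invertible_elem (2::'a)" "invertible_elem (2::'b)"
  shows "jordan_at_inverses C \<delta>"
proof unfold_locales
  show "\<delta> (X + Y) = \<delta> X + \<delta> Y" for X Y
    using \<delta> by (simp add: mn_derivable_at_def gmat_linear_def)
  have mn: "int_mult m (\<delta> gmat_one) + int_mult n (\<delta> (gmat_mult C T S)) =
      int_mult m (gmat_mult C (\<delta> S) T) + int_mult m (gmat_mult C S (\<delta> T)) +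
      int_mult n (gmat_mult C (\<delta> T) S) + int_mult n (gmat_mult C T (\<delta> S))"
    if "gmat_mult C S T = gmat_one" for S T
    using \<delta> that by (metis mn_derivable_at_def)
  \<comment> \<open>For \<open>S = T = 1\<close> the two sides are
    \<open>(m + n) \<delta>(1)\<close> and \<open>2 (m + n) \<delta>(1)\<close>.\<close>
  have "int_mult (m + n) (\<delta> gmat_one) = 0"
    using mn[of gmat_one gmat_one] by (simp add: gmat_mult_one int_mult_add_left)
  then have one: "\<delta> gmat_one = 0"
    by (rule torsion)
  fix S T
  assume ST: "gmat_mult C S T = gmat_one" and TS: "gmat_mult C T S = gmat_one"
  let ?P = "gmat_mult C (\<delta> S) T" and ?P' = "gmat_mult C T (\<delta> S)"
  let ?Q = "gmat_mult C S (\<delta> T)" and ?Q' = "gmat_mult C (\<delta> T) S"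
  have "int_mult m ?P + int_mult m ?Q + int_mult n ?Q' + int_mult n ?P' = 0"
    using mn[OF ST] by (simp add: TS one)
  moreover have "int_mult m ?Q' + int_mult m ?P' + int_mult n ?P + int_mult n ?Q = 0"
    using mn[OF TS] by (simp add: ST one)
  ultimately have "(int_mult m ?P + int_mult m ?Q + int_mult n ?Q' + int_mult n ?P') +
      (int_mult m ?Q' + int_mult m ?P' + int_mult n ?P + int_mult n ?Q) = 0"
    by simp
  then have "int_mult (m + n) (?P + ?P' + ?Q + ?Q') = 0"
    by (simp add: int_mult_add_left int_mult_add add_ac)
  then show "?P + ?P' + ?Q + ?Q' = 0"
    by (rule torsion)
qed fact+

theorem theorem4p1:
  fixes C :: "('r::ring_1, 'a::ring_1, 'm::ab_group_add, 'n::ab_group_add, 'b::ring_1) morita"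
    and \<delta> :: "('a, 'm, 'n, 'b) gmat \<Rightarrow> ('a, 'm, 'n, 'b) gmat"
    and m n :: int
  assumes "morita_context C"
    and "(\<exists>x::'m. x \<noteq> 0) \<or> (\<exists>y::'n. y \<noteq> 0)"
    and "m \<noteq> 0" and "n \<noteq> 0" and "m + n \<noteq> 0"
    and "char_is_not TYPE(('a, 'm, 'n, 'b) gmat) \<bar>3 * m * n * (m + n)\<bar>"
    and "m \<noteq> n \<longrightarrow> char_is_not TYPE(('a, 'm, 'n, 'b) gmat) \<bar>m - n\<bar>"
    and "invertible_elem (2::'a)" and "invertible_elem (2::'b)"
    and "\<forall>(A::'a) (B::'b). \<exists>k::int.
           invertible_elem (of_int k + A) \<and> invertible_elem (of_int k + B)"
    and "faithful_bimodule (lactM C) (ractM C)"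
    and "mn_derivable_at C m n \<delta> gmat_one"
  shows "jordan_derivation C \<delta>"
proof -
  interpret morita_context C
    by fact
  have torsion: "X = 0" if "k dvd 3 * m * n * (m + n)" "int_mult k X = 0"
    for k and X :: "('a, 'm, 'n, 'b) gmat"
    using char_is_not_dvd[OF assms(6)] that by simp
  interpret D: jordan_at_inverses C \<delta>
    by (rule jordan_at_inverses_if_derivable_at_one[OF assms(12) _ assms(8,9)])
      (rule torsion, simp_all)
  obtain u v where e: "\<delta> (Gmat 1 0 0 0) = Gmat 0 u v 0"
    using D.map_corner_unit by blast
  \<comment> \<open>For \<open>e = diag(1, 0)\<close> and \<open>g\<close> with off-diagonal entries
    \<open>u\<close> and \<open>- v\<close>, the commutator \<open>e g - g e\<close> has entries
    \<open>u\<close> and \<open>v\<close>, that is, it equals \<open>\<delta>(e)\<close>.\<close>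
  define \<iota> where "\<iota> = (\<lambda>X. gmat_mult C X (Gmat 0 u (- v) 0) - gmat_mult C (Gmat 0 u (- v) 0) X)"
  have \<iota>: "\<iota> (gmat_mult C S T + gmat_mult C T S) =
      gmat_mult C (\<iota> S) T + gmat_mult C S (\<iota> T) + gmat_mult C (\<iota> T) S + gmat_mult C T (\<iota> S)" for S T
    unfolding \<iota>_def by (rule inner_jordan)
  define \<Delta> where "\<Delta> = (\<lambda>X. \<delta> X - \<iota> X)"
  interpret \<Delta>: normalized_jordan_at_inverses C \<Delta>
  proof unfold_locales
    show "\<Delta> (X + Y) = \<Delta> X + \<Delta> Y" for X Y
      by (simp add: \<Delta>_def \<iota>_def D.additive algebra_simps)
    show "\<Delta> (Gmat 1 0 0 0) = 0"
      by (simp add: \<Delta>_def \<iota>_def e gmat_mult_def minus_gmat_def zero_gmat_def)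
    show "X = 0" if "X + X + X = 0" for X :: "('a, 'm, 'n, 'b) gmat"
      using torsion[of 3 X] that by (simp add: int_mult_3)
    fix S T
    assume ST: "gmat_mult C S T = gmat_one" and TS: "gmat_mult C T S = gmat_one"
    \<comment> \<open>With \<open>ST = TS = 1\<close> the left side of the Jordan identity is
      \<open>\<iota>(1 + 1) = 0\<close>, so \<open>\<iota>\<close> obeys the identity at inverse
      pairs and so does the difference \<open>\<Delta>\<close>.\<close>
    have "gmat_mult C (\<iota> S) T + gmat_mult C S (\<iota> T) + gmat_mult C (\<iota> T) S + gmat_mult C T (\<iota> S) = 0"
      using \<iota>[of S T] by (simp add: ST TS \<iota>_def U.distrib_left U.distrib_right gmat_mult_one)
    moreover have "gmat_mult C (\<Delta> S) T + gmat_mult C T (\<Delta> S) + gmat_mult C S (\<Delta> T) +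
        gmat_mult C (\<Delta> T) S =
        (gmat_mult C (\<delta> S) T + gmat_mult C T (\<delta> S) + gmat_mult C S (\<delta> T) + gmat_mult C (\<delta> T) S) -
        (gmat_mult C (\<iota> S) T + gmat_mult C S (\<iota> T) + gmat_mult C (\<iota> T) S + gmat_mult C T (\<iota> S))"
      by (simp add: \<Delta>_def algebra_simps)
    ultimately show "gmat_mult C (\<Delta> S) T + gmat_mult C T (\<Delta> S) + gmat_mult C S (\<Delta> T) +
        gmat_mult C (\<Delta> T) S = 0"
      using D.at_inverse[OF ST TS] by simp
  qed (use assms in blast)+
  have \<delta>: "\<delta> X = \<Delta> X + \<iota> X" for X
    by (simp add: \<Delta>_def)
  have "\<delta> (gmat_mult C S T + gmat_mult C T S) =
      gmat_mult C (\<delta> S) T + gmat_mult C S (\<delta> T) + gmat_mult C (\<delta> T) S + gmat_mult C T (\<delta> S)" for S T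
    unfolding \<delta> \<Delta>.jordan[OF assms(11)] \<iota>
    by (simp add: U.distrib_left U.distrib_right add_ac)
  then show ?thesis
    using assms(12) by (simp add: jordan_derivation_def mn_derivable_at_def)
qed

end
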